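(* $\mathbb{GS}$ has the Conjugate Property: if $G,H\in\mathbb{GS}$ satisfy $G+H\sim 0$, then $H\sim\overleftrightarrow{G}$.
   Context: A scoring game is written $G=\langle G^{\mathcal L}\mid G^{\mathcal R}\rangle$, where each of $G^{\mathcal L}$ (Left options) and $G^{\mathcal R}$ (Right options) is either a finite nonempty set of scoring games or an atom $\emptyset^{s}$, $s\in\mathbb R$ (the player to move on that side cannot move and the game ends with score $s$); game trees are finite. An atom occurring in $G$ is an atom of $G$ or of any follower of $G$. $G$ is guaranteed if for every follower $K$ of $G$: if $K^{\mathcal L}=\emptyset^\ell$ then $\ell\le s$ for every atom $\emptyset^s$ occurring in $K$, and if $K^{\mathcal R}=\emptyset^r$ then $s\le r$ for every atom $\emptyset^s$ occurring in $K$; $\mathbb{GS}$ is the class of guaranteed games. Disjunctive sum $G+H$: Left options are $G^L+H$ and $G+H^L$, except if both are left-atomic with atoms $\emptyset^{\ell_1},\emptyset^{\ell_2}$, then $(G+H)^{\mathcal L}=\emptyset^{\ell_1+\ell_2}$; Right symmetric. Stops: $Ls(G)=\ell$ if $G^{\mathcal L}=\emptyset^\ell$, otherwise $\max_{G^L}Rs(G^L)$; $Rs(G)=r$ if $G^{\mathcal R}=\emptyset^r$, otherwise $\min_{G^R}Ls(G^R)$. $G\succcurlyeq H$ iff $Ls(G+X)\ge Ls(H+X)$ and $Rs(G+X)\ge Rs(H+X)$ for all $X\in\mathbb{GS}$; $G\sim H$ iff both $G\succcurlyeq H$ and $H\succcurlyeq G$. $0=\langle\emptyset^0\mid\emptyset^0\rangle$.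 The conjugate $\overleftrightarrow{G}=\langle\overleftrightarrow{G^{\mathcal R}}\mid\overleftrightarrow{G^{\mathcal L}}\rangle$ is obtained by conjugating each option recursively, with an atom $\emptyset^s$ becoming $\emptyset^{-s}$ (interchanging the roles of Left and Right). *)

theory Defs
  imports Complex_Main "HOL-Library.FSet"
begin

datatype 'a side = Atom real | Opts "'a fset"

datatype game = Game (left: "game side") (right: "game side")

fun options :: "'a side \<Rightarrow> 'a fset" where
  "options (Atom s) = {||}"
| "options (Opts A) = A"

lemma size_option_left: "G' |\<in>| options L \<Longrightarrow> size G' < size (Game L R)"
proof (cases L)
  case (Opts A)
  assume "G' |\<in>| options L"
  then have "Suc (size G') \<le> (\<Sum>x\<in>fset A. Suc (size x))"
    using Opts by (intro member_le_sum[where f = "\<lambda>x. Suc (size x)"]) auto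
  then show ?thesis
    using Opts by simp
qed simp

lemma size_option_right: "G' |\<in>| options R \<Longrightarrow> size G' < size (Game L R)"
  using size_option_left[of G' R L] by simp

text \<open>Every game is a follower of itself.\<close>

inductive follower :: "game \<Rightarrow> game \<Rightarrow> bool" where
  follower_refl: "follower G G"
| follower_left: "follower K G \<Longrightarrow> K' |\<in>| options (left K) \<Longrightarrow> follower K' G"
| follower_right: "follower K G \<Longrightarrow> K' |\<in>| options (right K) \<Longrightarrow> follower K' G"

definition occurs_in :: "real \<Rightarrow> game \<Rightarrow> bool" where
  "occurs_in s G \<longleftrightarrow> (\<exists>K. follower K G \<and> (left K = Atom s \<or> right K = Atom s))"

text \<open>The datatype also contains terms with an empty set of options \<open>Opts {||}\<close>,
  which are not scoring games (a player without a move must have an atom).\<close>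

definition scoring_game :: "game \<Rightarrow> bool" where
  "scoring_game G \<longleftrightarrow>
     (\<forall>K. follower K G \<longrightarrow> left K \<noteq> Opts {||} \<and> right K \<noteq> Opts {||})"

definition guaranteed :: "game \<Rightarrow> bool" where
  "guaranteed G \<longleftrightarrow>
     (\<forall>K. follower K G \<longrightarrow>
        (\<forall>l. left K = Atom l \<longrightarrow> (\<forall>s. occurs_in s K \<longrightarrow> l \<le> s)) \<and>
        (\<forall>r. right K = Atom r \<longrightarrow> (\<forall>s. occurs_in s K \<longrightarrow> s \<le> r)))"

definition GS :: "game set" where
  "GS = {G. scoring_game G \<and> guaranteed G}"

instantiation game :: "{zero, plus}"
begin

definition zero_game :: game where
  "0 = Game (Atom 0) (Atom 0)"

function plus_game :: "game \<Rightarrow> game \<Rightarrow> game" where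
  "Game GL GR + Game HL HR = Game
     (case (GL, HL) of
        (Atom s, Atom t) \<Rightarrow> Atom (s + t)
      | _ \<Rightarrow> Opts ((\<lambda>G'. G' + Game HL HR) |`| options GL |\<union>| (\<lambda>H'. Game GL GR + H') |`| options HL))
     (case (GR, HR) of
        (Atom s, Atom t) \<Rightarrow> Atom (s + t)
      | _ \<Rightarrow> Opts ((\<lambda>G'. G' + Game HL HR) |`| options GR |\<union>| (\<lambda>H'. Game GL GR + H') |`| options HR))"
  by pat_completeness auto
termination
  by (relation "measure (\<lambda>(G, H). size G + size H)")
    (auto intro: size_option_left size_option_right simp del: game.size)

instance ..

end

function Ls :: "game \<Rightarrow> real" and Rs :: "game \<Rightarrow> real" where
  "Ls (Game L R) = (case L of Atom l \<Rightarrow> l | Opts A \<Rightarrow> Max (Rs ` fset A))"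
| "Rs (Game L R) = (case R of Atom r \<Rightarrow> r | Opts A \<Rightarrow> Min (Ls ` fset A))"
  by pat_completeness auto
termination
  by (relation "measure (case_sum size size)")
    (auto intro: size_option_left size_option_right simp del: game.size)

function conjugate :: "game \<Rightarrow> game" where
  "conjugate (Game L R) = Game
     (case R of Atom s \<Rightarrow> Atom (- s) | Opts A \<Rightarrow> Opts (conjugate |`| A))
     (case L of Atom s \<Rightarrow> Atom (- s) | Opts A \<Rightarrow> Opts (conjugate |`| A))"
  by pat_completeness auto
termination
  by (relation "measure size")
    (auto intro: size_option_left size_option_right simp del: game.size)

definition game_ge :: "game \<Rightarrow> game \<Rightarrow> bool" (infix "\<succcurlyeq>" 50) where
  "G \<succcurlyeq> H \<longleftrightarrow> (\<forall>X\<in>GS. Ls (G + X) \<ge> Ls (H + X) \<and> Rs (G + X) \<ge> Rs (H + X))"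

definition game_equiv :: "game \<Rightarrow> game \<Rightarrow> bool" (infix "\<sim>" 50) where
  "G \<sim> H \<longleftrightarrow> G \<succcurlyeq> H \<and> H \<succcurlyeq> G"

end

theory Submission
  imports Defs
begin

text \<open>
  For guaranteed \<open>G\<close>, the relation \<open>G \<succcurlyeq> 0\<close> has a purely strategic description (\<open>nonneg\<close>): Left, moving
  first, can secure a score of at least \<open>0\<close> even if Right may pass, and every Right move has a Left
  answer leading to a game of the same kind. With this description a swivel-chair argument composes
  winning strategies: \<open>X + h \<succcurlyeq> 0\<close> and \<open>Y + conjugate h \<succcurlyeq> 0\<close> imply \<open>X + Y \<succcurlyeq> 0\<close>. If \<open>G + H \<sim> 0\<close>, then
  \<open>G + H \<succcurlyeq> 0\<close> and \<open>conjugate G + conjugate H \<succcurlyeq> 0\<close>, hence \<open>G + conjugate G \<succcurlyeq> 0\<close>, and by conjugation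
  \<open>G + conjugate G \<sim> 0\<close>. Uniqueness of inverses gives the claim; no canonical forms are involved.
\<close>

section \<open>Options, atoms and stops of sums and conjugates\<close>

abbreviation moves :: "game \<Rightarrow> game fset" where
  "moves G \<equiv> options (left G) |\<union>| options (right G)"

lemma size_move_left: "G' |\<in>| options (left G) \<Longrightarrow> size G' < size G"
  using size_option_left[of G' "left G" "right G"] by simp

lemma size_move_right: "G' |\<in>| options (right G) \<Longrightarrow> size G' < size G"
  using size_option_right[of G' "right G" "left G"] by simp

lemma size_move: "G' |\<in>| moves G \<Longrightarrow> size G' < size G"
  using size_move_left size_move_right by auto

lemma game_induct [case_names move]:
  assumes "\<And>G. (\<And>G'. G' |\<in>| moves G \<Longrightarrow> P G') \<Longrightarrow> P G"
  shows "P G"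
  by (induction G rule: measure_induct_rule[of size]) (metis assms size_move)

lemma game_induct2 [case_names move]:
  assumes "\<And>G H. \<lbrakk>\<And>G'. G' |\<in>| moves G \<Longrightarrow> P G' H; \<And>H'. H' |\<in>| moves H \<Longrightarrow> P G H'\<rbrakk> \<Longrightarrow> P G H"
  shows "P G H"
proof (induction "size G + size H" arbitrary: G H rule: less_induct)
  case less
  show ?case
    by (rule assms; rule less; simp add: size_move del: funion_iff)
qed

section \<open>Followers, occurring atoms and membership in \<open>GS\<close>\<close>

lemma follower_trans: "follower K M \<Longrightarrow> follower M G \<Longrightarrow> follower K G"
  by (induction rule: follower.induct) (auto intro: follower.intros)

lemma follower_iff: "follower K G \<longleftrightarrow> K = G \<or> (\<exists>G'. G' |\<in>| moves G \<and> follower K G')"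
proof
  assume "follower K G"
  then show "K = G \<or> (\<exists>G'. G' |\<in>| moves G \<and> follower K G')"
    by (induction rule: follower.induct) (auto intro: follower.intros)
next
  assume "K = G \<or> (\<exists>G'. G' |\<in>| moves G \<and> follower K G')"
  then show "follower K G"
    using follower_trans[of K _ G] follower_left[OF follower_refl] follower_right[OF follower_refl]
    by (auto intro: follower_refl)
qed

lemma occurs_in_iff:
  "occurs_in s G \<longleftrightarrow> left G = Atom s \<or> right G = Atom s \<or> (\<exists>G'. G' |\<in>| moves G \<and> occurs_in s G')"
  unfolding occurs_in_def using follower_iff[of _ G] by metis

lemma occurs_in_move: "G' |\<in>| moves G \<Longrightarrow> occurs_in s G' \<Longrightarrow> occurs_in s G"
  using occurs_in_iff by blast

text \<open>Both conditions on followers unfold one move at a time, which makes membership in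
  \<open>GS\<close> fit for induction on moves.\<close>

lemma GS_iff:
  "G \<in> GS \<longleftrightarrow> left G \<noteq> Opts {||} \<and> right G \<noteq> Opts {||} \<and>
     (\<forall>l s. left G = Atom l \<longrightarrow> occurs_in s G \<longrightarrow> l \<le> s) \<and>
     (\<forall>r s. right G = Atom r \<longrightarrow> occurs_in s G \<longrightarrow> s \<le> r) \<and>
     (\<forall>G'. G' |\<in>| moves G \<longrightarrow> G' \<in> GS)"
  unfolding GS_def mem_Collect_eq scoring_game_def guaranteed_def
  using follower_iff[of _ G] by (smt (verit, best))

lemma GS_move: "G \<in> GS \<Longrightarrow> G' |\<in>| moves G \<Longrightarrow> G' \<in> GS"
  using GS_iff[of G] by blast

lemma GS_left_atom: "G \<in> GS \<Longrightarrow> left G = Atom l \<Longrightarrow> occurs_in s G \<Longrightarrow> l \<le> s"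
  using GS_iff[of G] by blast

lemma GS_right_atom: "G \<in> GS \<Longrightarrow> right G = Atom r \<Longrightarrow> occurs_in s G \<Longrightarrow> s \<le> r"
  using GS_iff[of G] by blast

lemma GS_nonempty: "G \<in> GS \<Longrightarrow> left G \<noteq> Opts {||} \<and> right G \<noteq> Opts {||}"
  using GS_iff[of G] by blast

section \<open>Stops in terms of atoms and moves\<close>

lemma Ls_atom: "left G = Atom l \<Longrightarrow> Ls G = l"
  by (cases G) simp

lemma Rs_atom: "right G = Atom r \<Longrightarrow> Rs G = r"
  by (cases G) simp

lemma Ls_ge_move: "G' |\<in>| options (left G) \<Longrightarrow> Rs G' \<le> Ls G"
  by (cases G; cases "left G") auto

lemma Rs_le_move: "G' |\<in>| options (right G) \<Longrightarrow> Rs G \<le> Ls G'"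
  by (cases G; cases "right G") auto

lemma Ls_attained:
  assumes "left G \<noteq> Opts {||}"
  obtains l where "left G = Atom l" "Ls G = l"
    | G' where "G' |\<in>| options (left G)" "Ls G = Rs G'"
proof (cases G)
  case (Game L R)
  show ?thesis
  proof (cases L)
    case (Opts A)
    then have "Max (Rs ` fset A) \<in> Rs ` fset A"
      using assms Game by (intro Max_in) auto
    then show ?thesis
      using that Game Opts by auto
  qed (use that Game in auto)
qed

lemma Rs_attained:
  assumes "right G \<noteq> Opts {||}"
  obtains r where "right G = Atom r" "Rs G = r"
    | G' where "G' |\<in>| options (right G)" "Rs G = Ls G'"
proof (cases G)
  case (Game L R)
  show ?thesis
  proof (cases R)
    case (Opts A)
    then have "Min (Ls ` fset A) \<in> Ls ` fset A"
      using assms Game by (intro Min_in) auto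
    then show ?thesis
      using that Game Opts by auto
  qed (use that Game in auto)
qed

section \<open>Algebra of disjunctive sums\<close>

lemma options_left_plus:
  "options (left (G + H)) = (\<lambda>G'. G' + H) |`| options (left G) |\<union>| (\<lambda>H'. G + H') |`| options (left H)"
  by (cases G; cases H; cases "left G"; cases "left H") auto

lemma options_right_plus:
  "options (right (G + H)) = (\<lambda>G'. G' + H) |`| options (right G) |\<union>| (\<lambda>H'. G + H') |`| options (right H)"
  by (cases G; cases H; cases "right G"; cases "right H") auto

lemma left_plus_atom:
  "left (G + H) = Atom s \<longleftrightarrow> (\<exists>a b. left G = Atom a \<and> left H = Atom b \<and> s = a + b)"
  by (cases G; cases H; cases "left G"; cases "left H") auto

lemma right_plus_atom:
  "right (G + H) = Atom s \<longleftrightarrow> (\<exists>a b. right G = Atom a \<and> right H = Atom b \<and> s = a + b)"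
  by (cases G; cases H; cases "right G"; cases "right H") auto

text \<open>Since \<open>options\<close> maps atoms and \<open>Opts {||}\<close> alike to the empty
  set, atoms are compared separately.\<close>

lemma side_eqI:
  assumes "\<And>s. S = Atom s \<longleftrightarrow> T = Atom s" "options S = options T"
  shows "S = T"
  by (cases S; cases T) (use assms in auto)

lemma moves_plus: "moves (G + H) = (\<lambda>G'. G' + H) |`| moves G |\<union>| (\<lambda>H'. G + H') |`| moves H"
  by (auto simp: options_left_plus options_right_plus)

lemma plus_nonempty:
  assumes "G \<in> GS" "H \<in> GS"
  shows "left (G + H) \<noteq> Opts {||}" "right (G + H) \<noteq> Opts {||}"
  using GS_nonempty[OF assms(1)] GS_nonempty[OF assms(2)]
  by (cases G; cases H; auto split: side.splits)+

text \<open>An atom of a sum arises where both summands have reached atoms on the same side.\<close>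

lemma occurs_in_plus:
  assumes "occurs_in s (G + H)"
  obtains a b where "occurs_in a G" "occurs_in b H" "s = a + b"
proof -
  have "occurs_in s (G + H) \<Longrightarrow> \<exists>a b. occurs_in a G \<and> occurs_in b H \<and> s = a + b"
  proof (induction G H rule: game_induct2)
    case (move G H)
    consider "left (G + H) = Atom s" | "right (G + H) = Atom s"
      | K where "K |\<in>| moves (G + H)" "occurs_in s K"
      using move.prems occurs_in_iff[of s "G + H"] by blast
    then show ?case
    proof cases
      case 1
      then show ?thesis using left_plus_atom occurs_in_iff by metis
    next
      case 2
      then show ?thesis using right_plus_atom occurs_in_iff by metis
    next
      case 3
      then consider G' where "G' |\<in>| moves G" "K = G' + H" | H' where "H' |\<in>| moves H" "K = G + H'"
        unfolding moves_plus by blast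
      then show ?thesis
        using move.IH 3 occurs_in_move by cases blast+
    qed
  qed
  then show ?thesis using assms that by blast
qed

text \<open>A left atom of the sum adds the left atoms of the summands, each a lower bound for all
  atoms of its summand; adding the two bounds covers every atom of the sum. Right atoms are
  symmetric.\<close>

lemma GS_plus: "G \<in> GS \<Longrightarrow> H \<in> GS \<Longrightarrow> G + H \<in> GS"
proof (induction G H rule: game_induct2)
  case (move G H)
  have "K \<in> GS" if "K |\<in>| moves (G + H)" for K
    using that move GS_move unfolding moves_plus by blast
  moreover have "l \<le> s" if l: "left (G + H) = Atom l" and s: "occurs_in s (G + H)" for l s
  proof -
    obtain a b where "occurs_in a G" "occurs_in b H" "s = a + b"
      using s by (rule occurs_in_plus)
    then show ?thesis
      using l move.prems GS_left_atom unfolding left_plus_atom by (blast intro: add_mono)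
  qed
  moreover have "s \<le> r" if r: "right (G + H) = Atom r" and s: "occurs_in s (G + H)" for r s
  proof -
    obtain a b where "occurs_in a G" "occurs_in b H" "s = a + b"
      using s by (rule occurs_in_plus)
    then show ?thesis
      using r move.prems GS_right_atom unfolding right_plus_atom by (blast intro: add_mono)
  qed
  ultimately show ?case
    using plus_nonempty[OF move.prems] GS_iff[of "G + H"] by blast
qed

lemma game_eqI: "left G = left H \<Longrightarrow> right G = right H \<Longrightarrow> G = H"
  by (rule game.expand) simp

lemma plus_game_commute: "G + H = H + (G :: game)"
proof (induction G H rule: game_induct2)
  case (move G H)
  show ?case
  proof (intro game_eqI side_eqI)
    show "options (left (G + H)) = options (left (H + G))"
      unfolding options_left_plus using move by (simp add: sup_commute cong: fset.map_cong)
    show "options (right (G + H)) = options (right (H + G))"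
      unfolding options_right_plus using move by (simp add: sup_commute cong: fset.map_cong)
  qed (auto simp: left_plus_atom right_plus_atom)
qed

lemma plus_game_assoc: "(G + H) + K = G + (H + (K :: game))"
proof (induction "size G + size H + size K" arbitrary: G H K rule: less_induct)
  case less
  have G: "G' + H + K = G' + (H + K)" if "G' |\<in>| moves G" for G'
    by (rule less) (use size_move[OF that] in simp)
  have H: "G + H' + K = G + (H' + K)" if "H' |\<in>| moves H" for H'
    by (rule less) (use size_move[OF that] in simp)
  have K: "G + H + K' = G + (H + K')" if "K' |\<in>| moves K" for K'
    by (rule less) (use size_move[OF that] in simp)
  show ?case
  proof (intro game_eqI side_eqI)
    show "options (left (G + H + K)) = options (left (G + (H + K)))"
      using G H K by (simp add: options_left_plus fimage_funion fset.map_comp sup_assoc cong: fset.map_cong)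
    show "options (right (G + H + K)) = options (right (G + (H + K)))"
      using G H K by (simp add: options_right_plus fimage_funion fset.map_comp sup_assoc cong: fset.map_cong)
  qed (auto simp: left_plus_atom right_plus_atom add.assoc)
qed

lemma plus_game_zero: "0 + G = (G :: game)"
proof (induction G rule: game_induct)
  case (move G)
  show ?case
  proof (intro game_eqI side_eqI)
    show "options (left (0 + G)) = options (left G)"
      using move by (simp add: options_left_plus cong: fset.map_cong) (simp add: zero_game_def)
    show "options (right (0 + G)) = options (right G)"
      using move by (simp add: options_right_plus cong: fset.map_cong) (simp add: zero_game_def)
  qed (auto simp: left_plus_atom right_plus_atom, auto simp: zero_game_def)
qed

section \<open>Conjugation\<close>

lemma options_left_conjugate: "options (left (conjugate G)) = conjugate |`| options (right G)"
  by (cases G; cases "right G") auto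

lemma options_right_conjugate: "options (right (conjugate G)) = conjugate |`| options (left G)"
  by (cases G; cases "left G") auto

lemma left_conjugate_atom: "left (conjugate G) = Atom s \<longleftrightarrow> right G = Atom (- s)"
  by (cases G; cases "right G") auto

lemma right_conjugate_atom: "right (conjugate G) = Atom s \<longleftrightarrow> left G = Atom (- s)"
  by (cases G; cases "left G") auto

lemma moves_conjugate: "moves (conjugate G) = conjugate |`| moves G"
  by (auto simp: options_left_conjugate options_right_conjugate)

lemma conjugate_conjugate [simp]: "conjugate (conjugate G) = G"
proof (induction G rule: game_induct)
  case (move G)
  show ?case
  proof (intro game_eqI side_eqI)
    show "options (left (conjugate (conjugate G))) = options (left G)"
      using move by (simp add: options_left_conjugate options_right_conjugate fset.map_comp cong: fset.map_cong)
    show "options (right (conjugate (conjugate G))) = options (right G)"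
      using move by (simp add: options_left_conjugate options_right_conjugate fset.map_comp cong: fset.map_cong)
  qed (auto simp: left_conjugate_atom right_conjugate_atom)
qed

lemma conjugate_plus: "conjugate (G + H) = conjugate G + conjugate H"
proof (induction G H rule: game_induct2)
  case (move G H)
  show ?case
  proof (intro game_eqI side_eqI)
    show "options (left (conjugate (G + H))) = options (left (conjugate G + conjugate H))"
      using move by (simp add: options_left_conjugate options_right_plus options_left_plus fimage_funion fset.map_comp cong: fset.map_cong)
    show "options (right (conjugate (G + H))) = options (right (conjugate G + conjugate H))"
      using move by (simp add: options_right_conjugate options_right_plus options_left_plus fimage_funion fset.map_comp cong: fset.map_cong)
  next
    fix s
    show "left (conjugate (G + H)) = Atom s \<longleftrightarrow> left (conjugate G + conjugate H) = Atom s"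
      by (cases G; cases H; cases "right G"; cases "right H") auto
    show "right (conjugate (G + H)) = Atom s \<longleftrightarrow> right (conjugate G + conjugate H) = Atom s"
      by (cases G; cases H; cases "left G"; cases "left H") auto
  qed
qed

lemma occurs_in_conjugate: "occurs_in s (conjugate G) \<longleftrightarrow> occurs_in (- s) G"
proof (induction G rule: game_induct)
  case (move G)
  show ?case
    unfolding occurs_in_iff[of s "conjugate G"] occurs_in_iff[of "- s" G] left_conjugate_atom right_conjugate_atom moves_conjugate
    using move by (auto simp: fimage_iff)
qed

lemma GS_conjugate: "G \<in> GS \<Longrightarrow> conjugate G \<in> GS"
proof (induction G rule: game_induct)
  case (move G)
  have "K \<in> GS" if "K |\<in>| moves (conjugate G)" for K
    using that move GS_move unfolding moves_conjugate by blast
  moreover have "left (conjugate G) \<noteq> Opts {||}" "right (conjugate G) \<noteq> Opts {||}"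
    using GS_nonempty[OF move.prems] by (cases G; cases "left G"; cases "right G"; auto)+
  moreover have "l \<le> s" if "left (conjugate G) = Atom l" "occurs_in s (conjugate G)" for l s
    using that GS_right_atom[OF move.prems] unfolding left_conjugate_atom occurs_in_conjugate by fastforce
  moreover have "s \<le> r" if "right (conjugate G) = Atom r" "occurs_in s (conjugate G)" for r s
    using that GS_left_atom[OF move.prems] unfolding right_conjugate_atom occurs_in_conjugate by fastforce
  ultimately show ?case
    using GS_iff[of "conjugate G"] by blast
qed

text \<open>Negation exchanges maxima and minima, and the nonempty option sets of games in
  \<open>GS\<close> ensure that both are attained.\<close>

lemma stops_conjugate: "G \<in> GS \<Longrightarrow> Ls (conjugate G) = - Rs G \<and> Rs (conjugate G) = - Ls G"
proof (induction G rule: game_induct)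
  case (move G)
  have IH: "Ls (conjugate G') = - Rs G' \<and> Rs (conjugate G') = - Ls G'" if "G' |\<in>| moves G" for G'
    using move GS_move that by blast
  note c = GS_nonempty[OF GS_conjugate[OF move.prems]] and g = GS_nonempty[OF move.prems]
  have "Ls (conjugate G) \<le> - Rs G"
    using conjunct1[OF c]
  proof (cases rule: Ls_attained)
    case (1 l)
    then show ?thesis by (simp add: left_conjugate_atom Rs_atom)
  next
    case (2 K)
    then show ?thesis
      unfolding options_left_conjugate using IH Rs_le_move by fastforce
  qed
  moreover have "- Rs G \<le> Ls (conjugate G)"
    using conjunct2[OF g]
  proof (cases rule: Rs_attained)
    case (1 r)
    then show ?thesis
      using Ls_atom[of "conjugate G" "- r"] by (simp add: left_conjugate_atom)
  next
    case (2 K)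
    then show ?thesis
      using IH[of K] Ls_ge_move[of "conjugate K" "conjugate G"] by (auto simp: options_left_conjugate)
  qed
  moreover have "- Ls G \<le> Rs (conjugate G)"
    using conjunct2[OF c]
  proof (cases rule: Rs_attained)
    case (1 r)
    then show ?thesis by (simp add: right_conjugate_atom Ls_atom)
  next
    case (2 K)
    then show ?thesis
      unfolding options_right_conjugate using IH Ls_ge_move by fastforce
  qed
  moreover have "Rs (conjugate G) \<le> - Ls G"
    using conjunct1[OF g]
  proof (cases rule: Ls_attained)
    case (1 l)
    then show ?thesis
      using Rs_atom[of "conjugate G" "- l"] by (simp add: right_conjugate_atom)
  next
    case (2 K)
    then show ?thesis
      using IH[of K] Rs_le_move[of "conjugate K" "conjugate G"] by (auto simp: options_right_conjugate)
  qed
  ultimately show ?case by linarith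
qed

section \<open>Left strategies\<close>

text \<open>
  \<open>holds_first G\<close> (\<open>holds_second G\<close>) says that Left, moving first (second), can secure a score of at
  least \<open>0\<close> when Right is allowed to pass. No condition on a right atom is needed, because in a
  guaranteed game it bounds every score from above.
\<close>

inductive holds_first :: "game \<Rightarrow> bool" where
  atom: "left G = Atom l \<Longrightarrow> 0 \<le> l \<Longrightarrow> holds_first G"
| move: "G' |\<in>| options (left G) \<Longrightarrow> holds_first G' \<Longrightarrow>
    (\<And>G''. G'' |\<in>| options (right G') \<Longrightarrow> holds_first G'') \<Longrightarrow> holds_first G"

definition holds_second :: "game \<Rightarrow> bool" where
  "holds_second G \<longleftrightarrow> holds_first G \<and> (\<forall>G'. G' |\<in>| options (right G) \<longrightarrow> holds_first G')"

text \<open>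
  Left must have a local answer to every Right move of \<open>G\<close>: if Right could win a tempo in \<open>G\<close>, a
  large zugzwang elsewhere would exploit it, whatever the scores in \<open>G\<close> are.
\<close>

inductive nonneg :: "game \<Rightarrow> bool" where
  "holds_first G \<Longrightarrow>
    (\<And>G'. G' |\<in>| options (right G) \<Longrightarrow> \<exists>G''. G'' |\<in>| options (left G') \<and> nonneg G'') \<Longrightarrow> nonneg G"

lemma holds_first_iff:
  "holds_first G \<longleftrightarrow> (\<exists>l. left G = Atom l \<and> 0 \<le> l) \<or> (\<exists>G'. G' |\<in>| options (left G) \<and> holds_second G')"
  unfolding holds_second_def holds_first.simps[of G] by blast

lemma nonneg_iff:
  "nonneg G \<longleftrightarrow> holds_first G \<and>
    (\<forall>G'. G' |\<in>| options (right G) \<longrightarrow> (\<exists>G''. G'' |\<in>| options (left G') \<and> nonneg G''))"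
  unfolding nonneg.simps[of G] by blast

text \<open>The local answer to a Right move is by induction a position that Left holds moving
  second, so Left holds moving first before it.\<close>

lemma nonneg_imp_holds_second: "nonneg G \<Longrightarrow> holds_second G"
proof (induction rule: nonneg.induct)
  case (1 G)
  then have "holds_first G'" if "G' |\<in>| options (right G)" for G'
    using that holds_first_iff[of G'] by blast
  then show ?case
    using 1 by (simp add: holds_second_def)
qed

text \<open>Left may move arbitrarily: \<open>GS\<close> always provides a move or an atom, and
  every atom suffices. The induction is on size because \<open>holds_first.move\<close> refers to
  positions two moves away.\<close>

lemma holds_if_atoms_nonneg:
  assumes "G \<in> GS" "\<And>s. occurs_in s G \<Longrightarrow> 0 \<le> s"
  shows "holds_first G" "holds_second G"
proof -
  have *: "holds_first G" if "G \<in> GS" "\<And>s. occurs_in s G \<Longrightarrow> 0 \<le> s" for G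
    using that
  proof (induction "size G" arbitrary: G rule: less_induct)
    case less
    show ?case
    proof (cases "left G")
      case (Atom l)
      then show ?thesis
        using less.prems occurs_in_iff[of l G] by (blast intro: holds_first.atom)
    next
      case (Opts A)
      then obtain G' where G': "G' |\<in>| options (left G)"
        using GS_nonempty[OF less.prems(1)] by auto
      have K: "holds_first K" if "size K < size G" "K |\<in>| moves M" "M \<in> GS" "\<And>s. occurs_in s M \<Longrightarrow> 0 \<le> s" for K M
        using less.hyps[OF that(1)] GS_move[OF that(3,2)] occurs_in_move[OF that(2)] that(4) by blast
      have M: "G' \<in> GS" "\<And>s. occurs_in s G' \<Longrightarrow> 0 \<le> s"
        using less.prems G' GS_move[of G G'] occurs_in_move[of G' G] by auto
      show ?thesis
      proof (rule holds_first.move[OF G'])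
        show "holds_first G'"
          using K[of G' G] less.prems G' size_move_left[OF G'] by auto
        show "holds_first G''" if "G'' |\<in>| options (right G')" for G''
          using K[of G'' G'] M that size_move_left[OF G'] size_move_right[OF that] by auto
      qed
    qed
  qed
  show "holds_first G"
    using * assms by blast
  moreover have "holds_first G'" if "G' |\<in>| options (right G)" for G'
    by (rule *) (use that assms GS_move[of G G'] occurs_in_move[of G' G] in auto)
  ultimately show "holds_second G"
    by (simp add: holds_second_def)
qed

text \<open>Along the line where Right always passes, Left's strategy ends at a nonnegative left
  atom.\<close>

lemma holds_first_occurs: "holds_first G \<Longrightarrow> \<exists>s. occurs_in s G \<and> 0 \<le> s"
proof (induction rule: holds_first.induct)
  case (atom G l)
  then show ?case using occurs_in_iff[of l G] by blast
next
  case (move G' G)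
  then show ?case using occurs_in_move[of G' G] by auto
qed

lemma holds_first_right_atom:
  assumes "G \<in> GS" "holds_first G" "right G = Atom r"
  shows "0 \<le> r"
  using holds_first_occurs[OF assms(2)] GS_right_atom[OF assms(1,3)] by fastforce

section \<open>Lower bounds on stops from Left strategies\<close>

lemma stops_ge_if_atoms_ge:
  "G \<in> GS \<Longrightarrow> (\<And>s. occurs_in s G \<Longrightarrow> c \<le> s) \<Longrightarrow> c \<le> Ls G \<and> c \<le> Rs G"
proof (induction G rule: game_induct)
  case (move G)
  have IH: "c \<le> Ls G' \<and> c \<le> Rs G'" if "G' |\<in>| moves G" for G'
    using move GS_move[of G G'] occurs_in_move[of G' G] that by blast
  have "c \<le> Ls G"
    using conjunct1[OF GS_nonempty[OF move.prems(1)]]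
    by (cases rule: Ls_attained) (use IH move.prems(2) occurs_in_iff[of _ G] in auto)
  moreover have "c \<le> Rs G"
    using conjunct2[OF GS_nonempty[OF move.prems(1)]]
    by (cases rule: Rs_attained) (use IH move.prems(2) occurs_in_iff[of _ G] in auto)
  ultimately show ?case ..
qed

text \<open>Left plays only in \<open>G\<close> and treats Right's moves in \<open>X\<close> as
  passes. Once \<open>G\<close> reaches a nonnegative left atom, guaranteedness puts every remaining
  atom of the sum at or above \<open>c\<close>.\<close>

lemma holds_imp_stops_plus_ge:
  "G \<in> GS \<Longrightarrow> X \<in> GS \<Longrightarrow> (\<And>s. occurs_in s X \<Longrightarrow> c \<le> s) \<Longrightarrow>
    (holds_first G \<longrightarrow> c \<le> Ls (G + X)) \<and> (holds_second G \<longrightarrow> c \<le> Rs (G + X))"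
proof (induction G X rule: game_induct2)
  case (move G X)
  have IH1: "(holds_first G' \<longrightarrow> c \<le> Ls (G' + X)) \<and> (holds_second G' \<longrightarrow> c \<le> Rs (G' + X))"
    if "G' |\<in>| moves G" for G'
    using that move.IH(1) move.prems GS_move by blast
  have IH2: "(holds_first G \<longrightarrow> c \<le> Ls (G + X')) \<and> (holds_second G \<longrightarrow> c \<le> Rs (G + X'))"
    if "X' |\<in>| moves X" for X'
    using that move.IH(2) move.prems GS_move occurs_in_move by blast
  have "c \<le> Ls (G + X)" if "holds_first G"
  proof -
    consider l where "left G = Atom l" "0 \<le> l" | G' where "G' |\<in>| options (left G)" "holds_second G'"
      using \<open>holds_first G\<close> holds_first_iff[of G] by blast
    then show ?thesis
    proof cases
      case 1
      have "c \<le> s" if s: "occurs_in s (G + X)" for s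
      proof -
        obtain a b where "occurs_in a G" "occurs_in b X" "s = a + b"
          using s by (rule occurs_in_plus)
        then show ?thesis
          using 1 GS_left_atom[OF move.prems(1)] move.prems(3) by fastforce
      qed
      then show ?thesis
        using stops_ge_if_atoms_ge GS_plus move.prems by blast
    next
      case 2
      then have "c \<le> Rs (G' + X)"
        using IH1 by auto
      also have "\<dots> \<le> Ls (G + X)"
        using 2 by (intro Ls_ge_move) (auto simp: options_left_plus)
      finally show ?thesis .
    qed
  qed
  moreover have "c \<le> Rs (G + X)" if "holds_second G"
    using plus_nonempty(2)[OF move.prems(1,2)]
  proof (cases rule: Rs_attained)
    case (1 s)
    then obtain a b where "right G = Atom a" "right X = Atom b" "s = a + b"
      using right_plus_atom by blast
    moreover have "0 \<le> a"
      using holds_first_right_atom calculation \<open>holds_second G\<close> move.prems(1) holds_second_def by blast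
    moreover have "c \<le> b"
      using move.prems(3)[of b] occurs_in_iff[of b X] calculation by blast
    ultimately show ?thesis using 1 by simp
  next
    case (2 K)
    then consider G' where "G' |\<in>| options (right G)" "K = G' + X"
      | X' where "X' |\<in>| options (right X)" "K = G + X'"
      unfolding options_right_plus by blast
    then have "c \<le> Ls K"
      by cases (use IH1 IH2 \<open>holds_second G\<close> holds_second_def in auto)
    then show ?thesis using 2 by simp
  qed
  ultimately show ?case by blast
qed

text \<open>Left follows optimal play in \<open>X\<close> and answers each Right move in
  \<open>G\<close> locally, so Right gains no tempo there. A move with its answer descends two
  levels in \<open>G\<close>, hence the induction on total size.\<close>

lemma nonneg_imp_stops_ge:
  "G \<in> GS \<Longrightarrow> X \<in> GS \<Longrightarrow> nonneg G \<Longrightarrow> Ls X \<le> Ls (G + X) \<and> Rs X \<le> Rs (G + X)"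
proof (induction "size G + size X" arbitrary: G X rule: less_induct)
  case less
  have IH2: "Ls X' \<le> Ls (G + X') \<and> Rs X' \<le> Rs (G + X')" if "X' |\<in>| moves X" for X'
    using less.hyps[of G X'] less.prems GS_move[OF less.prems(2) that] size_move[OF that] by simp
  have first: "holds_first G"
    using less.prems(3) nonneg_iff[of G] by blast
  have "Ls X \<le> Ls (G + X)"
    using conjunct1[OF GS_nonempty[OF less.prems(2)]]
  proof (cases rule: Ls_attained)
    case (1 l)
    \<comment> \<open>The left atom \<open>l\<close> bounds all atoms of \<open>X\<close> from
      below, so from here on Left can play in \<open>G\<close> alone.\<close>
    then show ?thesis
      using holds_imp_stops_plus_ge[OF less.prems(1,2), of l] first GS_left_atom[OF less.prems(2)] by blast
  next
    case (2 X')
    then have "Ls X \<le> Rs (G + X')"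
      using IH2 by simp
    also have "\<dots> \<le> Ls (G + X)"
      using 2 by (intro Ls_ge_move) (auto simp: options_left_plus)
    finally show ?thesis .
  qed
  moreover have "Rs X \<le> Rs (G + X)"
    using plus_nonempty(2)[OF less.prems(1,2)]
  proof (cases rule: Rs_attained)
    case (1 s)
    then obtain a b where "right G = Atom a" "right X = Atom b" "s = a + b"
      using right_plus_atom by blast
    then show ?thesis
      using holds_first_right_atom[OF less.prems(1) first] Rs_atom[of X b] 1 by simp
  next
    case (2 K)
    then consider G' where "G' |\<in>| options (right G)" "K = G' + X"
      | X' where "X' |\<in>| options (right X)" "K = G + X'"
      unfolding options_right_plus by blast
    then have "Rs X \<le> Ls K"
    proof cases
      case 1
      then obtain G'' where G'': "G'' |\<in>| options (left G')" "nonneg G''"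
        using less.prems(3) nonneg_iff[of G] by blast
      have "G'' \<in> GS"
        using 1 G'' GS_move[OF GS_move[OF less.prems(1)]] by blast
      then have "Rs X \<le> Rs (G'' + X)"
        using less.hyps[of G'' X] less.prems(2) G'' 1 size_move_left[of G'' G'] size_move_right[of G' G] by simp
      also have "\<dots> \<le> Ls K"
        using G'' 1 by (intro Ls_ge_move) (auto simp: options_left_plus)
      finally show ?thesis .
    next
      case 2
      then show ?thesis
        using IH2[of X'] Rs_le_move[of X' X] by simp
    qed
    then show ?thesis using 2 by simp
  qed
  ultimately show ?case ..
qed

lemma nonneg_imp_ge_zero: "G \<in> GS \<Longrightarrow> nonneg G \<Longrightarrow> G \<succcurlyeq> 0"
  unfolding game_ge_def plus_game_zero using nonneg_imp_stops_ge by blast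

text \<open>No atom of \<open>X\<close> is worse for Left than any atom of \<open>K\<close>, so Left
  plays on \<open>X + Y\<close> as if on \<open>Y + K\<close>, taking Right's moves in
  \<open>X\<close> for passes.\<close>

lemma holds_replace_summand:
  assumes "X \<in> GS" "Y \<in> GS" "K \<in> GS"
    and "\<And>s. occurs_in s X \<Longrightarrow> a \<le> s" and "\<And>s. occurs_in s K \<Longrightarrow> s \<le> a"
  shows "(holds_first (Y + K) \<longrightarrow> holds_first (X + Y)) \<and> (holds_second (Y + K) \<longrightarrow> holds_second (X + Y))"
  using assms
proof (induction "size X + size Y + size K" arbitrary: X Y K rule: less_induct)
  case less
  have X: "(holds_first (Y + K) \<longrightarrow> holds_first (X' + Y))" if "X' |\<in>| moves X" for X'
    using less.hyps[of X' Y K] less.prems GS_move[OF less.prems(1) that] size_move[OF that] occurs_in_move[OF that]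
    by simp
  have Y: "(holds_first (Y' + K) \<longrightarrow> holds_first (X + Y')) \<and> (holds_second (Y' + K) \<longrightarrow> holds_second (X + Y'))"
    if "Y' |\<in>| moves Y" for Y'
    using less.hyps[of X Y' K] less.prems GS_move[OF less.prems(2) that] size_move[OF that] by simp
  have K: "(holds_first (Y + K') \<longrightarrow> holds_first (X + Y))" if "K' |\<in>| moves K" for K'
    using less.hyps[of X Y K'] less.prems GS_move[OF less.prems(3) that] size_move[OF that] occurs_in_move[OF that]
    by simp
  have first: "holds_first (X + Y)" if YK: "holds_first (Y + K)"
  proof -
    consider y k where "left Y = Atom y" "left K = Atom k" "0 \<le> y + k"
      | Y' where "Y' |\<in>| options (left Y)" "holds_second (Y' + K)"
      | K' where "K' |\<in>| options (left K)" "holds_second (Y + K')"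
      using YK unfolding holds_first_iff[of "Y + K"] left_plus_atom options_left_plus by blast
    then show ?thesis
    proof cases
      case 1
      \<comment> \<open>Atoms of \<open>X\<close> are at least \<open>a\<close>, hence at least
        \<open>k\<close>, and those of \<open>Y\<close> at least \<open>y\<close>; so Left has
        already secured the score.\<close>
      have "0 \<le> s" if s: "occurs_in s (X + Y)" for s
      proof -
        obtain u v where "occurs_in u X" "occurs_in v Y" "s = u + v"
          using s by (rule occurs_in_plus)
        moreover have "k \<le> a"
          using 1 less.prems(5)[of k] occurs_in_iff[of k K] by blast
        ultimately show ?thesis
          using 1 GS_left_atom[OF less.prems(2)] less.prems(4) by fastforce
      qed
      then show ?thesis
        using holds_if_atoms_nonneg(1) GS_plus less.prems by blast
    next
      case 2
      then have "holds_second (X + Y')"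
        using Y by auto
      then show ?thesis
        using 2 holds_first_iff[of "X + Y"] unfolding options_left_plus by blast
    next
      case 3
      \<comment> \<open>A Left move in \<open>K\<close> has no counterpart in \<open>X + Y\<close>;
        Right's imagined pass after it leaves Left to move.\<close>
      then show ?thesis
        using K holds_second_def by auto
    qed
  qed
  moreover have "holds_second (X + Y)" if "holds_second (Y + K)"
    using that first X Y unfolding holds_second_def options_right_plus by blast
  ultimately show ?case by blast
qed

section \<open>Composing strategies across a game and its conjugate\<close>

lemma conjugate_moveI:
  "h' |\<in>| options (left h) \<Longrightarrow> conjugate h' |\<in>| options (right (conjugate h))"
  by (simp add: options_right_conjugate)

lemma size_conjugate_move:
  "h' |\<in>| moves h \<Longrightarrow> size (conjugate h') < size (conjugate h)"
  using size_move[of "conjugate h'" "conjugate h"] by (auto simp: moves_conjugate)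

text \<open>
  Left plays \<open>X + Y\<close> by simulating the two boards \<open>X + h\<close> and \<open>Y + conjugate h\<close>. An answer in \<open>h\<close>
  on one board is copied as a Right move on the other one, until the answer falls in \<open>X\<close> or \<open>Y\<close>. If
  the first board stops with left atoms \<open>a\<close> and \<open>b\<close>, then guaranteedness bounds the atoms of
  \<open>conjugate h\<close> above by \<open>- b \<le> a\<close>, so \<open>X\<close> may stand in for \<open>conjugate h\<close> on the second board.
\<close>

lemma holds_cut:
  assumes "X \<in> GS" "Y \<in> GS" "h \<in> GS"
  shows "(holds_first (X + h) \<longrightarrow> holds_second (Y + conjugate h) \<longrightarrow> holds_first (X + Y)) \<and>
    (holds_second (X + h) \<longrightarrow> holds_second (Y + conjugate h) \<longrightarrow> holds_second (X + Y))"
  using assms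
proof (induction "size X + size Y + (size h + size (conjugate h))" arbitrary: X Y h rule: less_induct)
  \<comment> \<open>The measure is invariant under exchanging the boards, which replaces \<open>h\<close> by \<open>conjugate h\<close>.\<close>
  case less
  have first: "holds_first (X + Y)" if XY: "holds_first (X + h)" "holds_second (Y + conjugate h)"
  proof -
    have Yh: "holds_first (Y + conjugate h)"
      using XY(2) holds_second_def by blast
    consider a b where "left X = Atom a" "left h = Atom b" "0 \<le> a + b"
      | X' where "X' |\<in>| options (left X)" "holds_second (X' + h)"
      | h' where "h' |\<in>| options (left h)" "holds_second (X + h')"
      using XY(1) unfolding holds_first_iff[of "X + h"] left_plus_atom options_left_plus by blast
    then show ?thesis
    proof cases
      case 1
      have "s \<le> a" if "occurs_in s (conjugate h)" for s
        using GS_left_atom[OF less.prems(3)] 1 that unfolding occurs_in_conjugate by fastforce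
      then show ?thesis
        using holds_replace_summand[of X Y "conjugate h" a] GS_left_atom[OF less.prems(1)] 1 less.prems Yh GS_conjugate by blast
    next
      case 2
      then have "holds_second (X' + Y)"
        using less.hyps[of X' Y h] less.prems XY(2) GS_move[of X X'] size_move_left[of X' X] by simp
      then show ?thesis
        using 2 holds_first_iff[of "X + Y"] unfolding options_left_plus by blast
    next
      case 3
      have m: "h' |\<in>| moves h" using 3 by simp
      have "holds_first (Y + conjugate h')"
        using XY(2) conjugate_moveI[OF 3(1)] unfolding holds_second_def options_right_plus by blast
      \<comment> \<open>The boards change roles: with \<open>conjugate h'\<close> as the connecting
        game, the second board carries its conjugate \<open>h'\<close>, where \<open>X + h'\<close>
        is held moving second.\<close>
      then have "holds_first (Y + X)"
        using less.hyps[of Y X "conjugate h'"] less.prems 3 GS_conjugate GS_move[OF less.prems(3) m]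
          size_move[OF m] size_conjugate_move[OF m] by simp
      then show ?thesis by (simp add: plus_game_commute)
    qed
  qed
  have second: "holds_second (X + Y)" if XY: "holds_second (X + h)" "holds_second (Y + conjugate h)"
    unfolding holds_second_def
  proof (intro conjI allI impI)
    show "holds_first (X + Y)"
      using first XY holds_second_def by blast
    fix K
    assume "K |\<in>| options (right (X + Y))"
    then consider X' where "X' |\<in>| options (right X)" "K = X' + Y"
      | Y' where "Y' |\<in>| options (right Y)" "K = X + Y'"
      unfolding options_right_plus by blast
    then show "holds_first K"
    proof cases
      case 1
      then have "holds_first (X' + h)"
        using XY(1) unfolding holds_second_def options_right_plus by blast
      then show ?thesis
        using less.hyps[of X' Y h] XY(2) less.prems GS_move[of X X'] 1 size_move_right[of X' X] by simp
    next
      case 2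
      then have "holds_first (Y' + conjugate h)"
        using XY(2) unfolding holds_second_def options_right_plus by blast
      then have "holds_first (Y' + X)"
        using less.hyps[of Y' X "conjugate h"] XY(1) less.prems GS_move[of Y Y'] GS_conjugate 2
          size_move_right[of Y' Y] by simp
      then show ?thesis
        using 2 by (simp add: plus_game_commute)
    qed
  qed
  show ?case
    using first second by blast
qed

text \<open>The simulation of \<open>holds_cut\<close> again, now for local answers:
  \<open>?answer\<close> is the condition for Left to move. It demands an actual move, and copied
  moves shrink \<open>h\<close>, so the chain of copies ends with a move in \<open>X\<close> or
  \<open>Y\<close>.\<close>

lemma nonneg_cut:
  assumes "X \<in> GS" "Y \<in> GS" "h \<in> GS" "nonneg (X + h)" "nonneg (Y + conjugate h)"
  shows "nonneg (X + Y)"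
proof -
  let ?answer = "\<lambda>G. \<exists>K. K |\<in>| options (left G) \<and> nonneg K"
  have "(?answer (X + h) \<longrightarrow> nonneg (Y + conjugate h) \<longrightarrow> ?answer (X + Y)) \<and>
    (nonneg (X + h) \<longrightarrow> nonneg (Y + conjugate h) \<longrightarrow> nonneg (X + Y))"
    using assms(1-3)
  proof (induction "size X + size Y + (size h + size (conjugate h))" arbitrary: X Y h rule: less_induct)
    case less
    have "?answer (X + Y)" if "?answer (X + h)" and B: "nonneg (Y + conjugate h)"
    proof -
      consider X' where "X' |\<in>| options (left X)" "nonneg (X' + h)"
        | h' where "h' |\<in>| options (left h)" "nonneg (X + h')"
        using \<open>?answer (X + h)\<close> unfolding options_left_plus by blast
      then show ?thesis
      proof cases
        case 1
        then have "nonneg (X' + Y)"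
          using less.hyps[of X' Y h] less.prems GS_move[of X X'] size_move_left[of X' X] B by simp
        then show ?thesis
          using 1 unfolding options_left_plus by blast
      next
        case 2
        have m: "h' |\<in>| moves h" using 2 by simp
        have "?answer (Y + conjugate h')"
          using B conjugate_moveI[OF 2(1)] unfolding nonneg_iff[of "Y + conjugate h"] options_right_plus by blast
        then have "?answer (Y + X)"
          using less.hyps[of Y X "conjugate h'"] less.prems 2 GS_conjugate GS_move[OF less.prems(3) m]
            size_move[OF m] size_conjugate_move[OF m] by simp
        then show ?thesis by (simp add: plus_game_commute)
      qed
    qed
    moreover have "nonneg (X + Y)" if A: "nonneg (X + h)" and B: "nonneg (Y + conjugate h)"
      unfolding nonneg_iff[of "X + Y"]
    proof (intro conjI allI impI)
      show "holds_first (X + Y)"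
        using holds_cut[OF less.prems] nonneg_imp_holds_second A B holds_second_def by blast
      fix K
      assume "K |\<in>| options (right (X + Y))"
      then consider X' where "X' |\<in>| options (right X)" "K = X' + Y"
        | Y' where "Y' |\<in>| options (right Y)" "K = X + Y'"
        unfolding options_right_plus by blast
      then show "?answer K"
      proof cases
        case 1
        then have "?answer (X' + h)"
          using A unfolding nonneg_iff[of "X + h"] options_right_plus by blast
        then show ?thesis
          using less.hyps[of X' Y h] B less.prems GS_move[of X X'] 1 size_move_right[of X' X] by simp
      next
        case 2
        then have "?answer (Y' + conjugate h)"
          using B unfolding nonneg_iff[of "Y + conjugate h"] options_right_plus by blast
        then have "?answer (Y' + X)"
          using less.hyps[of Y' X "conjugate h"] A less.prems GS_move[of Y Y'] GS_conjugate 2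
            size_move_right[of Y' Y] by simp
        then show ?thesis
          using 2 by (simp add: plus_game_commute)
      qed
    qed
    ultimately show ?case by blast
  qed
  then show ?thesis using assms by blast
qed

section \<open>Test games\<close>

definition number :: "real \<Rightarrow> game" where
  "number s = Game (Atom s) (Atom s)"

lemma number_simps [simp]: "left (number s) = Atom s" "right (number s) = Atom s" "Ls (number s) = s"
  by (simp_all add: number_def)

lemma GS_number [simp]: "number s \<in> GS"
  unfolding GS_iff[of "number s"] by (auto simp: occurs_in_iff[of _ "number s"])

text \<open>With no atom at the root, guaranteedness imposes nothing beyond the options.\<close>

lemma GS_Opts:
  "A \<noteq> {||} \<Longrightarrow> B \<noteq> {||} \<Longrightarrow> (\<And>G. G |\<in>| A |\<union>| B \<Longrightarrow> G \<in> GS) \<Longrightarrow> Game (Opts A) (Opts B) \<in> GS"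
  unfolding GS_iff[of "Game (Opts A) (Opts B)"] by auto

text \<open>Neither player can move in \<open>number s\<close>, so it only shifts every final
  score.\<close>

lemma stops_plus_number: "G \<in> GS \<Longrightarrow> Ls (G + number s) = Ls G + s \<and> Rs (G + number s) = Rs G + s"
proof (induction G rule: game_induct)
  case (move G)
  have IH: "Ls (G' + number s) = Ls G' + s \<and> Rs (G' + number s) = Rs G' + s" if "G' |\<in>| moves G" for G'
    using move GS_move that by blast
  have L: "options (left (G + number s)) = (\<lambda>G'. G' + number s) |`| options (left G)"
    and R: "options (right (G + number s)) = (\<lambda>G'. G' + number s) |`| options (right G)"
    by (simp_all add: options_left_plus options_right_plus)
  note ne = plus_nonempty[OF move.prems GS_number, of s] and g = GS_nonempty[OF move.prems]
  have "Ls (G + number s) \<le> Ls G + s"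
    using ne(1)
    by (cases rule: Ls_attained) (use IH Ls_ge_move[of _ G] Ls_atom[of G] in \<open>auto simp: L left_plus_atom\<close>)
  moreover have "Ls G + s \<le> Ls (G + number s)"
    using conjunct1[OF g]
    by (cases rule: Ls_attained)
      (use IH Ls_ge_move[of _ "G + number s"] Ls_atom[of "G + number s"] in \<open>force simp: L left_plus_atom\<close>)+
  moreover have "Rs G + s \<le> Rs (G + number s)"
    using ne(2)
    by (cases rule: Rs_attained) (use IH Rs_le_move[of _ G] Rs_atom[of G] in \<open>auto simp: R right_plus_atom\<close>)
  moreover have "Rs (G + number s) \<le> Rs G + s"
    using conjunct2[OF g]
    by (cases rule: Rs_attained)
      (use IH Rs_le_move[of _ "G + number s"] Rs_atom[of "G + number s"] in \<open>force simp: R right_plus_atom\<close>)+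
  ultimately show ?case by linarith
qed

text \<open>\<open>right_waits n\<close> offers Right \<open>n\<close> passes: as a summand it turns \<open>Ls\<close> into \<open>holds_first\<close>.\<close>

fun right_waits :: "nat \<Rightarrow> game" where
  "right_waits 0 = number 0"
| "right_waits (Suc n) = Game (Atom 0) (Opts {|right_waits n|})"

lemma left_right_waits [simp]: "left (right_waits n) = Atom 0"
  by (cases n) simp_all

lemma occurs_in_right_waits: "occurs_in s (right_waits n) \<Longrightarrow> s = 0"
proof (induction n)
  case 0
  then show ?case by (auto simp: occurs_in_iff[of _ "number 0"])
next
  case (Suc n)
  then show ?case by (auto simp: occurs_in_iff[of _ "Game _ _"])
qed

lemma GS_right_waits: "right_waits n \<in> GS"
proof (induction n)
  case (Suc n)
  then show ?case
    unfolding GS_iff[of "right_waits (Suc n)"]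
    using occurs_in_right_waits[of _ "Suc n"] by (auto simp del: right_waits.simps(2), auto)
qed simp

lemma Ls_right_waits: "Ls (right_waits n) = 0"
  by (simp add: Ls_atom)

text \<open>Right's passes become moves in \<open>right_waits n\<close>, where Left cannot move.
  Each wait is preceded by a Left move that shrinks \<open>G\<close>, so \<open>n\<close> waits
  never run out too early.\<close>

lemma holds_first_if_stop_right_waits:
  assumes "G \<in> GS" "size G \<le> n" "0 \<le> Ls (G + right_waits n)"
  shows "holds_first G"
  using assms
proof (induction "size G" arbitrary: G n rule: less_induct)
  case less
  show ?case
    using plus_nonempty(1)[OF less.prems(1) GS_right_waits, of n]
  proof (cases rule: Ls_attained)
    case (1 l)
    then show ?thesis
      using less.prems(3) by (auto simp: left_plus_atom intro: holds_first.atom)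
  next
    case (2 K)
    then obtain G' where G': "G' |\<in>| options (left G)" "K = G' + right_waits n"
      by (auto simp: options_left_plus)
    have sz: "size G' < size G" and GS: "G' \<in> GS"
      using G' size_move_left GS_move[OF less.prems(1)] by auto
    then obtain m where m: "n = Suc m" "size G' \<le> m"
      using less.prems(2) by (cases n) auto
    have K: "0 \<le> Rs (G' + right_waits n)"
      using 2 G' less.prems(3) by simp
    show ?thesis
    proof (rule holds_first.move[OF G'(1)])
      have "0 \<le> Ls (G' + right_waits m)"
        using K Rs_le_move[of "G' + right_waits m" "G' + right_waits n"] m by (auto simp: options_right_plus)
      then show "holds_first G'"
        using less.hyps[OF sz GS m(2)] by blast
    next
      fix G'' assume G'': "G'' |\<in>| options (right G')"
      have "0 \<le> Ls (G'' + right_waits n)"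
        using K Rs_le_move[of "G'' + right_waits n" "G' + right_waits n"] G'' by (auto simp: options_right_plus)
      then show "holds_first G''"
        using less.hyps[of G'' n] G'' sz GS GS_move[of G' G''] size_move_right[of G'' G'] less.prems(2) by simp
    qed
  qed
qed

section \<open>Recovering strategies from tests\<close>

lemma finite_upper_bound_real:
  fixes f :: "'a \<Rightarrow> real"
  assumes "finite A"
  obtains M where "\<And>x. x \<in> A \<Longrightarrow> f x < M"
proof
  show "f x < Max (f ` A) + 1" if "x \<in> A" for x
    using Max_ge[of "f ` A" "f x"] that assms by (simp add: order_le_less_trans[OF _ less_add_one])
qed

text \<open>A failed comparison of Right stops is turned into one of Left stops by prefixing a Left
  move, and a number then normalises the stop to \<open>0\<close>.\<close>

lemma not_ge_zero_witness:
  assumes "G \<in> GS" "\<not> G \<succcurlyeq> 0"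
  obtains Y where "Y \<in> GS" "Ls Y = 0" "Ls (G + Y) < 0"
proof -
  have "\<exists>X\<in>GS. Ls (G + X) < Ls X"
  proof -
    obtain X where X: "X \<in> GS" "Ls (G + X) < Ls X \<or> Rs (G + X) < Rs X"
      using assms(2) unfolding game_ge_def plus_game_zero by force
    show ?thesis
    proof (cases "Ls (G + X) < Ls X")
      case False
      obtain M where M: "\<And>G'. G' \<in> fset (options (left G)) \<Longrightarrow> Ls G' - Rs X < M"
        using finite_upper_bound_real[of "fset (options (left G))" "\<lambda>G'. Ls G' - Rs X"] by auto
      \<comment> \<open>Left must move to \<open>X\<close> at once: after any Left move in
        \<open>G\<close>, Right takes \<open>number (- M)\<close>, and \<open>M\<close> is large
        enough to bring the score below \<open>Rs X\<close>.\<close>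
      define Y where "Y = Game (Opts {|X|}) (Opts {|number (- M)|})"
      have Y: "Y \<in> GS"
        unfolding Y_def using X by (intro GS_Opts) auto
      have "Ls (G + Y) < Rs X"
        using plus_nonempty(1)[OF assms(1) Y]
      proof (cases rule: Ls_attained)
        case (1 l)
        then show ?thesis by (simp add: left_plus_atom Y_def)
      next
        case (2 K)
        then consider G' where "G' |\<in>| options (left G)" "K = G' + Y" | "K = G + X"
          by (auto simp: options_left_plus Y_def)
        then have "Rs K < Rs X"
        proof cases
          case 1
          have "Rs K \<le> Ls (G' + number (- M))"
            using 1 by (intro Rs_le_move) (auto simp: options_right_plus Y_def)
          also have "\<dots> = Ls G' - M"
            using stops_plus_number[of G' "- M"] GS_move[OF assms(1), of G'] 1 by simp
          finally show ?thesis
            using M[OF 1(1)] by simp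
        next
          case 2
          then show ?thesis using False X by simp
        qed
        then show ?thesis using 2 by simp
      qed
      moreover have "Ls Y = Rs X"
        by (simp add: Y_def)
      ultimately show ?thesis
        using Y by (intro bexI[of _ Y]) simp_all
    qed (use X in blast)
  qed
  then obtain X where X: "X \<in> GS" "Ls (G + X) < Ls X" by blast
  show ?thesis
  proof (rule that)
    show "X + number (- Ls X) \<in> GS"
      using X GS_plus by simp
    show "Ls (X + number (- Ls X)) = 0"
      using X stops_plus_number by simp
    show "Ls (G + (X + number (- Ls X))) < 0"
      using X assms(1) GS_plus stops_plus_number[of "G + X"] by (simp flip: plus_game_assoc)
  qed
qed

text \<open>Each clause of \<open>nonneg\<close> is forced by a test game:
  \<open>right_waits\<close> for the first, a zugzwang assembled from refutations of Left's answers
  for the second.\<close>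

lemma ge_zero_imp_nonneg:
  assumes "G \<in> GS" "G \<succcurlyeq> 0"
  shows "nonneg G"
  using assms
proof (induction "size G" arbitrary: G rule: less_induct)
  case less
  have ge: "Ls X \<le> Ls (G + X)" "Rs X \<le> Rs (G + X)" if "X \<in> GS" for X
    using less.prems(2) that unfolding game_ge_def plus_game_zero by blast+
  have "holds_first G"
    using holds_first_if_stop_right_waits[OF less.prems(1) order_refl] ge(1)[OF GS_right_waits]
    by (simp add: Ls_right_waits)
  moreover have "\<exists>G''. G'' |\<in>| options (left G') \<and> nonneg G''" if G': "G' |\<in>| options (right G)" for G'
  proof (rule ccontr)
    assume none: "\<nexists>G''. G'' |\<in>| options (left G') \<and> nonneg G''"
    have GS': "G' \<in> GS"
      using GS_move[OF less.prems(1)] G' by simp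
    have "\<exists>Y. Y \<in> GS \<and> Ls Y = 0 \<and> Ls (G'' + Y) < 0" if G'': "G'' |\<in>| options (left G')" for G''
    proof -
      have "G'' \<in> GS"
        using GS_move[OF GS'] G'' by simp
      \<comment> \<open>Contraposition of the induction hypothesis for the smaller game
        \<open>G''\<close>.\<close>
      moreover have "\<not> G'' \<succcurlyeq> 0"
        using less.hyps[of G''] none G'' calculation size_move_left[OF G''] size_move_right[OF G'] by auto
      ultimately show ?thesis
        using not_ge_zero_witness by metis
    qed
    then obtain Y where Y: "\<And>G''. G'' |\<in>| options (left G') \<Longrightarrow> Y G'' \<in> GS \<and> Ls (Y G'') = 0 \<and> Ls (G'' + Y G'') < 0"
      by metis
    \<comment> \<open>A zugzwang for Left: after Right's move to \<open>G'\<close>, either Left loses \<open>M\<close> in \<open>X\<close>, or Right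
      answers Left's \<open>G''\<close> with the test game \<open>Y G''\<close> refuting it.\<close>
    define M where "M = Rs G' + 1"
    define X where "X = Game (Opts {|number (- M)|}) (Opts (finsert (number 0) (Y |`| options (left G'))))"
    have X: "X \<in> GS"
      unfolding X_def using Y by (intro GS_Opts) auto
    \<comment> \<open>All Right options of \<open>X\<close> have Left stop \<open>0\<close>;
      \<open>number 0\<close> provides one even if \<open>G'\<close> has no Left options.\<close>
    have "Rs X = 0"
    proof (rule Rs_attained[of X])
      show "right X \<noteq> Opts {||}" by (simp add: X_def)
    qed (use Y in \<open>auto simp: X_def\<close>)
    moreover have "Rs (G + X) \<le> Ls (G' + X)"
      using G' by (intro Rs_le_move) (auto simp: options_right_plus)
    moreover have "Ls (G' + X) < 0"
      using plus_nonempty(1)[OF GS' X]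
    proof (cases rule: Ls_attained)
      case (1 l)
      then show ?thesis by (simp add: left_plus_atom X_def)
    next
      case (2 K)
      then consider G'' where "G'' |\<in>| options (left G')" "K = G'' + X" | "K = G' + number (- M)"
        by (auto simp: options_left_plus X_def)
      then have "Rs K < 0"
      proof cases
        case 1
        have "Rs K \<le> Ls (G'' + Y G'')"
          using 1 by (intro Rs_le_move) (auto simp: options_right_plus X_def)
        then show ?thesis
          using Y[OF 1(1)] by linarith
      next
        case 2
        then show ?thesis
          using stops_plus_number[OF GS', of "- M"] by (simp add: M_def)
      qed
      then show ?thesis using 2 by simp
    qed
    ultimately show False
      using ge(2)[OF X] by simp
  qed
  ultimately show ?case
    using nonneg_iff[of G] by blast
qed

section \<open>The conjugate property\<close>

text \<open>Testing conjugates with \<open>X\<close> amounts to testing the original games with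
  \<open>conjugate X\<close> and negating the exchanged stops.\<close>

lemma game_ge_conjugate:
  assumes "G \<in> GS" "H \<in> GS" "G \<succcurlyeq> H"
  shows "conjugate H \<succcurlyeq> conjugate G"
  unfolding game_ge_def
proof
  fix X assume X: "X \<in> GS"
  have *: "conjugate K + X = conjugate (K + conjugate X)" for K
    by (simp add: conjugate_plus)
  show "Ls (conjugate G + X) \<le> Ls (conjugate H + X) \<and> Rs (conjugate G + X) \<le> Rs (conjugate H + X)"
    using assms GS_conjugate[OF X] unfolding * game_ge_def by (simp add: stops_conjugate GS_plus)
qed

lemma conjugate_zero [simp]: "conjugate 0 = 0"
  by (simp add: zero_game_def)

lemma GS_zero [simp]: "0 \<in> GS"
  using GS_number[of 0] by (simp add: number_def zero_game_def)

theorem theorem45: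
  fixes G H :: game
  assumes "G \<in> GS" and "H \<in> GS" and "G + H \<sim> 0"
  shows "H \<sim> conjugate G"
proof -
  have GH: "G + H \<succcurlyeq> 0" "0 \<succcurlyeq> G + H"
    using assms(3) by (simp_all add: game_equiv_def)
  have "conjugate G + conjugate H \<succcurlyeq> 0"
    using game_ge_conjugate[OF _ _ GH(2)] assms(1,2) by (simp add: GS_plus conjugate_plus)
  \<comment> \<open>The connecting game is \<open>H\<close>: the boards are \<open>G + H\<close> and
    \<open>conjugate G + conjugate H\<close>.\<close>
  then have "nonneg (G + conjugate G)"
    using GH(1) assms(1,2) by (intro nonneg_cut[of G "conjugate G" H] ge_zero_imp_nonneg GS_plus GS_conjugate)
  then have ge: "G + conjugate G \<succcurlyeq> 0"
    using assms(1) by (intro nonneg_imp_ge_zero GS_plus GS_conjugate)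
  \<comment> \<open>Up to commutativity, \<open>G + conjugate G\<close> is its own
    conjugate.\<close>
  then have le: "0 \<succcurlyeq> G + conjugate G"
    using game_ge_conjugate[OF _ _ ge] assms(1)
    by (simp add: GS_plus GS_conjugate conjugate_plus plus_game_commute)
  have stops: "Ls (K + X) = Ls X \<and> Rs (K + X) = Rs X" if "K \<succcurlyeq> 0" "0 \<succcurlyeq> K" "X \<in> GS" for K X
    using that unfolding game_ge_def plus_game_zero by (meson order_antisym)
  have "Ls (H + X) = Ls (conjugate G + X) \<and> Rs (H + X) = Rs (conjugate G + X)" if X: "X \<in> GS" for X
  proof -
    \<comment> \<open>Uniqueness of inverses: in either grouping the first summand is equivalent to
      \<open>0\<close> and leaves the stops of the other unchanged.\<close>
    have "(G + conjugate G) + (H + X) = (G + H) + (conjugate G + X)"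
      by (metis plus_game_assoc plus_game_commute)
    then show ?thesis
      using stops[OF ge le, of "H + X"] stops[OF GH, of "conjugate G + X"] assms(1,2) X
      by (simp add: GS_plus GS_conjugate)
  qed
  then show ?thesis
    unfolding game_equiv_def game_ge_def by simp
qed

end
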